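(* Let $(M,d_M)$ be a locally finite metric space which is not coarsely embeddable into $L_1$. Let $D$ be a constant and, for each $n\in\mathbb{N}$, let $M_n\subset M$ be a finite set and $\mu_n$ a probability measure on $M_n\times M_n$ such that (i) $d_M(u,v)\ge n$ for each $(u,v)\in\operatorname{supp}\mu_n$; (ii) for each Lipschitz function $f:M\to L_1$, $$\int_{M_n\times M_n}\|f(u)-f(v)\|_{L_1}\,d\mu_n(u,v)\le D\,\operatorname{Lip}(f).$$ For positive integers $n,s$ let $G(n,s)$ be the graph with vertex set $M_n$ in which two distinct vertices are joined by an edge if and only if their $d_M$-distance is $\le s$, and let $\nu_n$ be the measure on $M_n$ given by $\nu_n(A)=\mu_n(A\times M_n)$. Let $s$ and $n$ be positive integers such that $2n>s>8D$, and let $\varphi(D,s)=\frac{s}{4D}-2$. Then $G(n,s)$ contains an induced subgraph $F$ with $d_M$-diameter $\ge n-\frac{s}{2}$ such that each nonempty set $A$ of vertices of $F$ of $d_M$-diameter $<n-\frac{s}{2}$ satisfies $$\nu_n(\delta_F A)>\varphi(D,s)\,\nu_n(A).$$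
   Context: A metric space is locally finite if every ball in it has finitely many elements. A map $f:A\to B$ between metric spaces is a coarse embedding if there exist non-decreasing functions $\rho_1,\rho_2:[0,\infty)\to[0,\infty)$ such that $\rho_1(d_A(x,y))\le d_B(f(x),f(y))\le\rho_2(d_A(x,y))$ for all $x,y\in A$ and $\lim_{r\to\infty}\rho_1(r)=\infty$. $L_1$ denotes the Banach space $L_1[0,1]$. $\operatorname{Lip}(f)$ is the Lipschitz constant of $f$. $\operatorname{supp}\mu_n$ is the set of points of the finite set $M_n\times M_n$ having positive $\mu_n$-measure. The $d_M$-diameter of a subgraph or of a set of vertices is the diameter of the vertex set with respect to the metric $d_M$ (not the graph distance). For an induced subgraph $F$ of $G(n,s)$ and a set $A$ of vertices of $F$, the vertex boundary $\delta_F A$ is the set of vertices of $F$ not in $A$ that are adjacent in $F$ to some vertex of $A$. (A known theorem guarantees that for every locally finite $M$ not coarsely embeddable into $L_1$ such $D$, depending on $M$ only, and such $M_n$, $\mu_n$ exist.) *)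

theory Defs
  imports "HOL-Probability.Probability"
begin

text \<open>The Banach space \<open>L\<^sub>1[0,1]\<close>: Lebesgue integrable functions on the unit interval
  modulo equality almost everywhere.\<close>

abbreviation unit_leb :: "real measure" where
  "unit_leb \<equiv> lebesgue_on {0..1}"

definition L1_rel :: "(real \<Rightarrow> real) \<Rightarrow> (real \<Rightarrow> real) \<Rightarrow> bool" where
  "L1_rel f g \<longleftrightarrow>
     integrable unit_leb f \<and> integrable unit_leb g \<and> (AE x in unit_leb. f x = g x)"

lemma part_equivp_L1_rel: "part_equivp L1_rel"
proof (rule part_equivpI)
  show "\<exists>f. L1_rel f f"
    by (rule exI[of _ "\<lambda>_. 0"]) (simp add: L1_rel_def)
  show "symp L1_rel"
    by (rule sympI) (auto simp: L1_rel_def)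
  show "transp L1_rel"
    by (rule transpI) (auto simp: L1_rel_def)
qed

quotient_type L1 = "real \<Rightarrow> real" / partial: L1_rel
  by (rule part_equivp_L1_rel)

instantiation L1 :: real_normed_vector
begin

lift_definition zero_L1 :: L1 is "\<lambda>_. 0"
  by (simp add: L1_rel_def)

lift_definition plus_L1 :: "L1 \<Rightarrow> L1 \<Rightarrow> L1" is "\<lambda>f g x. f x + g x"
  by (auto simp: L1_rel_def)

lift_definition uminus_L1 :: "L1 \<Rightarrow> L1" is "\<lambda>f x. - f x"
  by (auto simp: L1_rel_def)

lift_definition minus_L1 :: "L1 \<Rightarrow> L1 \<Rightarrow> L1" is "\<lambda>f g x. f x - g x"
  by (auto simp: L1_rel_def)

lift_definition scaleR_L1 :: "real \<Rightarrow> L1 \<Rightarrow> L1" is "\<lambda>c f x. c * f x"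
  by (auto simp: L1_rel_def)

lift_definition norm_L1 :: "L1 \<Rightarrow> real" is "\<lambda>f. LINT x|unit_leb. \<bar>f x\<bar>"
  unfolding L1_rel_def by (auto intro!: integral_cong_AE)

definition sgn_L1 :: "L1 \<Rightarrow> L1" where
  "sgn_L1 f = inverse (norm f) *\<^sub>R f"

definition dist_L1 :: "L1 \<Rightarrow> L1 \<Rightarrow> real" where
  "dist_L1 f g = norm (f - g)"

definition uniformity_L1 :: "(L1 \<times> L1) filter" where
  "uniformity_L1 = (INF e\<in>{0<..}. principal {(f, g). dist f g < e})"

definition open_L1 :: "L1 set \<Rightarrow> bool" where
  "open_L1 U \<longleftrightarrow> (\<forall>f\<in>U. \<forall>\<^sub>F (f', g) in uniformity. f' = f \<longrightarrow> g \<in> U)"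

instance
proof
  fix f g h :: L1 and a b :: real and U :: "L1 set"
  show "f + g + h = f + (g + h)"
    by transfer (auto simp: L1_rel_def algebra_simps)
  show "f + g = g + f"
    by transfer (auto simp: L1_rel_def algebra_simps)
  show "0 + f = f"
    by transfer (auto simp: L1_rel_def)
  show "- f + f = 0"
    by transfer (auto simp: L1_rel_def)
  show "f - g = f + - g"
    by transfer (auto simp: L1_rel_def)
  show "a *\<^sub>R (f + g) = a *\<^sub>R f + a *\<^sub>R g"
    by transfer (auto simp: L1_rel_def algebra_simps)
  show "(a + b) *\<^sub>R f = a *\<^sub>R f + b *\<^sub>R f"
    by transfer (auto simp: L1_rel_def algebra_simps)
  show "a *\<^sub>R b *\<^sub>R f = (a * b) *\<^sub>R f"
    by transfer (auto simp: L1_rel_def algebra_simps)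
  show "1 *\<^sub>R f = f"
    by transfer (auto simp: L1_rel_def)
  show "dist f g = norm (f - g)"
    by (rule dist_L1_def)
  show "sgn f = inverse (norm f) *\<^sub>R f"
    by (rule sgn_L1_def)
  show "uniformity = (INF e\<in>{0<..}. principal {(f, g :: L1). dist f g < e})"
    by (rule uniformity_L1_def)
  show "open U \<longleftrightarrow> (\<forall>f\<in>U. \<forall>\<^sub>F (f', g) in uniformity. f' = f \<longrightarrow> g \<in> U)"
    by (rule open_L1_def)
  show "norm f = 0 \<longleftrightarrow> f = 0"
  proof transfer
    fix f assume "L1_rel f f"
    then have "integrable unit_leb f"
      by (simp add: L1_rel_def)
    then show "(LINT x|unit_leb. \<bar>f x\<bar>) = 0 \<longleftrightarrow> L1_rel f (\<lambda>_. 0)"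
      by (subst integral_nonneg_eq_0_iff_AE) (auto simp: L1_rel_def)
  qed
  show "norm (f + g) \<le> norm f + norm g"
  proof transfer
    fix f g assume "L1_rel f f" "L1_rel g g"
    then have *: "integrable unit_leb f" "integrable unit_leb g"
      by (auto simp: L1_rel_def)
    then have "(LINT x|unit_leb. \<bar>f x + g x\<bar>) \<le> (LINT x|unit_leb. \<bar>f x\<bar> + \<bar>g x\<bar>)"
      by (intro integral_mono) auto
    with * show "(LINT x|unit_leb. \<bar>f x + g x\<bar>)
        \<le> (LINT x|unit_leb. \<bar>f x\<bar>) + (LINT x|unit_leb. \<bar>g x\<bar>)"
      by simp
  qed
  show "norm (a *\<^sub>R f) = \<bar>a\<bar> * norm f"
    by transfer (simp add: abs_mult)
qed

end

definition locally_finite_space :: "'a::metric_space itself \<Rightarrow> bool" where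
  "locally_finite_space _ \<longleftrightarrow> (\<forall>(x::'a) r. finite (ball x r))"

definition coarse_embedding :: "('a::metric_space \<Rightarrow> 'b::metric_space) \<Rightarrow> bool" where
  "coarse_embedding f \<longleftrightarrow>
     (\<exists>\<rho>\<^sub>1 \<rho>\<^sub>2 :: real \<Rightarrow> real.
        \<rho>\<^sub>1 \<in> {0..} \<rightarrow> {0..} \<and> \<rho>\<^sub>2 \<in> {0..} \<rightarrow> {0..} \<and>
        mono_on {0..} \<rho>\<^sub>1 \<and> mono_on {0..} \<rho>\<^sub>2 \<and>
        (\<forall>x y. \<rho>\<^sub>1 (dist x y) \<le> dist (f x) (f y) \<and> dist (f x) (f y) \<le> \<rho>\<^sub>2 (dist x y)) \<and>
        filterlim \<rho>\<^sub>1 at_top at_top)"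

definition lipschitz_map :: "('a::metric_space \<Rightarrow> 'b::metric_space) \<Rightarrow> bool" where
  "lipschitz_map f \<longleftrightarrow> (\<exists>C. C-lipschitz_on UNIV f)"

definition Lip :: "('a::metric_space \<Rightarrow> 'b::metric_space) \<Rightarrow> real" where
  "Lip f = Inf {C. C-lipschitz_on UNIV f}"

definition prob_measure_on :: "'a set \<Rightarrow> 'a measure \<Rightarrow> bool" where
  "prob_measure_on S \<mu> \<longleftrightarrow> prob_space \<mu> \<and> space \<mu> = S \<and> sets \<mu> = Pow S"

definition supp :: "'a measure \<Rightarrow> 'a set" where
  "supp \<mu> = {p \<in> space \<mu>. measure \<mu> {p} > 0}"

text \<open>Simple graphs are pairs of a vertex set and a set of two-element edges.\<close>

type_synonym 'a graph = "'a set \<times> 'a set set"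

abbreviation verts :: "'a graph \<Rightarrow> 'a set" where
  "verts \<equiv> fst"

abbreviation edges :: "'a graph \<Rightarrow> 'a set set" where
  "edges \<equiv> snd"

definition proximity_graph :: "'a::metric_space set \<Rightarrow> real \<Rightarrow> 'a graph" where
  "proximity_graph V s = (V, {{u, v} |u v. u \<in> V \<and> v \<in> V \<and> u \<noteq> v \<and> dist u v \<le> s})"

definition induced_subgraph :: "'a graph \<Rightarrow> 'a graph \<Rightarrow> bool" where
  "induced_subgraph F G \<longleftrightarrow>
     verts F \<subseteq> verts G \<and> edges F = {e \<in> edges G. e \<subseteq> verts F}"

definition vertex_boundary :: "'a graph \<Rightarrow> 'a set \<Rightarrow> 'a set" where
  "vertex_boundary F A = {v \<in> verts F - A. \<exists>a\<in>A. {a, v} \<in> edges F}"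

definition first_marginal :: "'a set \<Rightarrow> ('a \<times> 'a) measure \<Rightarrow> 'a set \<Rightarrow> real" where
  "first_marginal V \<mu> A = measure \<mu> (A \<times> V)"

definition phi :: "real \<Rightarrow> real \<Rightarrow> real" where
  "phi D s = s / (4 * D) - 2"

end

theory Submission imports Defs begin

text \<open>
  If no induced subgraph expands, then sets of small diameter violating the expansion inequality
  can be removed one after another, each together with its boundary, until no vertex is left. The
  removed sets \<open>A\<^sub>i\<close> are pairwise more than \<open>s\<close> apart and their union \<open>B\<close> satisfies
  \<open>\<nu>(B) \<ge> 1 / (1 + \<phi>)\<close>. For every choice of signs, the signed sum of the bump functions
  \<open>max 0 (s/2 - d(x, A\<^sub>i))\<close> is 1-Lipschitz. If \<open>u \<in> A\<^sub>i\<close> and \<open>d(u, v) \<ge> n\<close>, then \<open>v\<close> lies outside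
  the support of the \<open>i\<close>-th bump, so that averaging \<open>\<bar>f u - f v\<bar>\<close> over the signs yields at least
  \<open>s/2\<close>. Integrating gives \<open>s/2 \<cdot> \<nu>(B) \<le> D\<close>, which is incompatible with the value of \<open>\<phi>\<close>.
  The random signs make real-valued functions suffice.
\<close>

text \<open>The multiples of a unit vector form an isometric copy of the reals, so the integral
  inequality for \<open>L1\<close>-valued maps becomes available for real-valued functions.\<close>

lemma ex_norm_1_L1: "\<exists>e::L1. norm e = 1"
proof transfer
  have "integrable unit_leb (\<lambda>_. 1::real)"
    by (simp add: emeasure_restrict_space)
  then show "\<exists>e\<in>{f. L1_rel f f}. (LINT x|unit_leb. \<bar>e x\<bar>) = 1"
    by (intro bexI[of _ "\<lambda>_. 1"]) (auto simp: L1_rel_def measure_restrict_space)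
qed

lemma Lip_nonneg: "lipschitz_map f \<Longrightarrow> 0 \<le> Lip f"
  unfolding Lip_def lipschitz_map_def
  by (rule cInf_greatest) (auto intro: lipschitz_on_nonneg)

lemma Lip_le: "C-lipschitz_on UNIV f \<Longrightarrow> Lip f \<le> C"
  unfolding Lip_def
  by (rule cInf_lower) (auto intro!: bdd_belowI[of _ 0] lipschitz_on_nonneg)

lemma lipschitz_on_scaleR_unit:
  fixes e :: "'b::real_normed_vector"
  assumes "C-lipschitz_on U f" and "norm e = 1"
  shows "C-lipschitz_on U (\<lambda>x. f x *\<^sub>R e)"
  using assms by (auto simp: lipschitz_on_def dist_norm simp flip: scaleR_left_diff_distrib)

section \<open>Probability measures on finite sets\<close>

lemma AE_supp:
  assumes "prob_measure_on S \<mu>" and "finite S"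
  shows "AE p in \<mu>. p \<in> supp \<mu>"
proof -
  interpret prob_space \<mu> using assms(1) by (simp add: prob_measure_on_def)
  have S: "space \<mu> = S" "sets \<mu> = Pow S"
    using assms(1) by (auto simp: prob_measure_on_def)
  have "{p} \<in> null_sets \<mu>" if "p \<in> S - supp \<mu>" for p
    using that S by (auto simp: supp_def null_sets_def emeasure_eq_measure zero_less_measure_iff)
  then have "(\<Union>p\<in>S - supp \<mu>. {p}) \<in> null_sets \<mu>"
    using assms(2) by (intro null_sets_UN' countable_finite) auto
  then show ?thesis
    by (rule AE_I') (auto simp: S)
qed

lemma integrable_finite_space:
  fixes g :: "'a \<Rightarrow> real"
  assumes "prob_measure_on S \<mu>" and "finite S"
  shows "integrable \<mu> g"
proof -
  interpret prob_space \<mu> using assms(1) by (simp add: prob_measure_on_def)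
  have S: "space \<mu> = S" "sets \<mu> = Pow S"
    using assms(1) by (auto simp: prob_measure_on_def)
  show ?thesis
  proof (rule integrable_const_bound)
    show "AE p in \<mu>. norm (g p) \<le> (\<Sum>q\<in>S. norm (g q))"
      using assms(2) by (intro AE_I2) (auto simp: S intro!: member_le_sum)
    show "g \<in> borel_measurable \<mu>"
      by (rule measurableI) (auto simp: S)
  qed
qed

text \<open>A Markov-type bound. The lower bound on \<open>g\<close> is asked for only at support
  points because the remaining points form a null set.\<close>

lemma measure_le_integral:
  fixes g :: "'a \<Rightarrow> real"
  assumes \<mu>: "prob_measure_on S \<mu>" and "finite S" and "X \<subseteq> S"
    and nonneg: "\<And>p. 0 \<le> g p" and ge: "\<And>p. p \<in> X \<Longrightarrow> p \<in> supp \<mu> \<Longrightarrow> c \<le> g p"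
  shows "c * measure \<mu> X \<le> (LINT p|\<mu>. g p)"
proof -
  have S: "space \<mu> = S" "sets \<mu> = Pow S"
    using \<mu> by (auto simp: prob_measure_on_def)
  have "c * measure \<mu> X = (LINT p|\<mu>. c * indicator X p)"
    using \<open>X \<subseteq> S\<close> by (simp add: S Int_absorb2)
  also have "\<dots> \<le> (LINT p|\<mu>. g p)"
  proof (rule integral_mono_AE)
    show "AE p in \<mu>. c * indicator X p \<le> g p"
      using AE_supp[OF \<mu> \<open>finite S\<close>] by eventually_elim (auto simp: indicator_def nonneg ge)
  qed (rule integrable_finite_space[OF \<mu> \<open>finite S\<close>])+
  finally show ?thesis .
qed

section \<open>Bump functions around separated sets\<close>

definition bump :: "real \<Rightarrow> 'a::metric_space set \<Rightarrow> 'a \<Rightarrow> real" where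
  "bump t A x = max 0 (t - infdist x A)"

text \<open>The function lives in the open \<open>t\<close>-neighbourhood of \<open>B\<close> and
  stays below a cone of height \<open>t\<close> there. An explicit witness \<open>b\<close> feeds
  directly into triangle inequalities.\<close>

definition near_support :: "real \<Rightarrow> 'a::metric_space set \<Rightarrow> ('a \<Rightarrow> real) \<Rightarrow> bool" where
  "near_support t B f \<longleftrightarrow> (\<forall>x. f x \<noteq> 0 \<longrightarrow> (\<exists>b\<in>B. \<bar>f x\<bar> \<le> t - dist x b))"

lemma bump_lipschitz: "1-lipschitz_on UNIV (bump t A)"
proof (rule lipschitz_onI)
  fix x y
  show "dist (bump t A x) (bump t A y) \<le> 1 * dist x y"
    using infdist_triangle[of x A y] infdist_triangle[of y A x]
    by (auto simp: bump_def dist_real_def dist_commute)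
qed simp

text \<open>A finite nonempty set attains its distance to \<open>x\<close>, which yields the
  witness.\<close>

lemma near_support_bump:
  assumes "finite A" and "A \<noteq> {}"
  shows "near_support t A (bump t A)"
  unfolding near_support_def
proof (intro allI impI)
  fix x assume "bump t A x \<noteq> 0"
  have "infdist x A = Min (dist x ` A)"
    using assms by (simp add: infdist_notempty cInf_eq_Min)
  then have "infdist x A \<in> dist x ` A"
    using assms by simp
  with \<open>bump t A x \<noteq> 0\<close> show "\<exists>a\<in>A. \<bar>bump t A x\<bar> \<le> t - dist x a"
    by (auto simp: bump_def max_def split: if_splits)
qed

text \<open>At a point where both functions are nonzero, the two witnesses would be less than
  \<open>2 * t\<close> apart.\<close>

lemma near_support_disjoint:
  assumes "near_support t A f" and "near_support t B g"
    and "\<And>a b. a \<in> A \<Longrightarrow> b \<in> B \<Longrightarrow> 2 * t \<le> dist a b" and "f x \<noteq> 0"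
  shows "g x = 0"
proof (rule ccontr)
  assume "g x \<noteq> 0"
  then obtain a b where "a \<in> A" "b \<in> B" "\<bar>f x\<bar> \<le> t - dist x a" "\<bar>g x\<bar> \<le> t - dist x b"
    using assms unfolding near_support_def by blast
  with assms(3)[of a b] assms(4) dist_triangle3[of a b x] show False
    by linarith
qed

lemma near_support_add:
  assumes "near_support t A f" and "near_support t B g"
    and "\<And>a b. a \<in> A \<Longrightarrow> b \<in> B \<Longrightarrow> 2 * t \<le> dist a b"
  shows "near_support t (A \<union> B) (\<lambda>x. f x + g x)"
  using near_support_disjoint[OF assms] assms(1,2) unfolding near_support_def
  by (metis Un_iff add.left_neutral add.right_neutral)

text \<open>The critical case has \<open>x\<close> in one support and \<open>y\<close> in the other.
  There \<open>2 * t \<le> dist a b\<close> and the path from \<open>a\<close> via \<open>x\<close>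
  and \<open>y\<close> to \<open>b\<close> give
  \<open>\<bar>f x\<bar> + \<bar>g y\<bar> \<le> dist x y\<close>, so adding does not worsen the
  constant 1.\<close>

lemma lipschitz_on_add_near_support:
  assumes "near_support t A f" and "near_support t B g"
    and sep: "\<And>a b. a \<in> A \<Longrightarrow> b \<in> B \<Longrightarrow> 2 * t \<le> dist a b"
    and "1-lipschitz_on UNIV f" and "1-lipschitz_on UNIV g"
  shows "1-lipschitz_on UNIV (\<lambda>x. f x + g x)"
proof (rule lipschitz_onI)
  have f: "\<bar>f x - f y\<bar> \<le> dist x y" and g: "\<bar>g x - g y\<bar> \<le> dist x y" for x y
    using lipschitz_onD[OF assms(4), of x y] lipschitz_onD[OF assms(5), of x y]
    by (simp_all add: dist_real_def)
  have disj: "f x = 0 \<or> g x = 0" for x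
    using near_support_disjoint[OF assms(1-3)] by blast
  have cross: "\<bar>f x\<bar> + \<bar>g y\<bar> \<le> dist x y" if nz: "f x \<noteq> 0" "g y \<noteq> 0" for x y
  proof -
    obtain a b where "a \<in> A" "b \<in> B" "\<bar>f x\<bar> \<le> t - dist x a" "\<bar>g y\<bar> \<le> t - dist y b"
      using assms(1,2) nz unfolding near_support_def by blast
    with sep[of a b] dist_triangle3[of a b x] dist_triangle[of x b y] show ?thesis
      by linarith
  qed
  fix x y
  show "dist (f x + g x) (f y + g y) \<le> 1 * dist x y"
    using f[of x y] g[of x y] disj[of x] disj[of y] cross[of x y] cross[of y x] dist_commute[of x y]
    by (cases "f x = 0"; cases "f y = 0"; cases "g x = 0"; cases "g y = 0")
      (simp_all add: dist_real_def)
qed simp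

section \<open>Separated pieces and signed sums of their bumps\<close>

text \<open>Adding one piece at a time matches both the successive removal of sets and the choice of
  one further sign.\<close>

inductive separated_union :: "real \<Rightarrow> real \<Rightarrow> 'a::metric_space set \<Rightarrow> bool" for t r where
  empty: "separated_union t r {}"
| insert: "\<lbrakk>separated_union t r B; finite A; A \<noteq> {}; diameter A < r;
    \<And>a b. a \<in> A \<Longrightarrow> b \<in> B \<Longrightarrow> 2 * t \<le> dist a b\<rbrakk> \<Longrightarrow> separated_union t r (A \<union> B)"

text \<open>The list \<open>fs\<close> consists of all signed sums of the bumps around the pieces.\<close>

lemma separated_union_imp_functions:
  assumes "separated_union t r B" and "0 \<le> t"
  shows "\<exists>fs. fs \<noteq> [] \<and> (\<forall>f\<in>set fs. 1-lipschitz_on UNIV f \<and> near_support t B f) \<and>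
    (\<forall>u\<in>B. \<forall>v. r + t \<le> dist u v \<longrightarrow> t * length fs \<le> (\<Sum>f\<leftarrow>fs. \<bar>f u - f v\<bar>))"
  using assms(1)
proof induction
  case empty
  have "1-lipschitz_on UNIV (\<lambda>_::'a. 0::real)"
    by (rule lipschitz_onI) simp_all
  \<comment> \<open>The empty sum is kept as one entry: the list must be nonempty because the final
    estimate cancels its length.\<close>
  then show ?case
    by (intro exI[of _ "[\<lambda>_. 0]"]) (simp add: near_support_def)
next
  case (insert B A)
  let ?h = "bump t A"
  from insert.IH obtain fs where fs: "fs \<noteq> []"
    "\<And>f. f \<in> set fs \<Longrightarrow> 1-lipschitz_on UNIV f \<and> near_support t B f"
    "\<And>u v. u \<in> B \<Longrightarrow> r + t \<le> dist u v \<Longrightarrow> t * length fs \<le> (\<Sum>f\<leftarrow>fs. \<bar>f u - f v\<bar>)"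
    by blast
  define gs where "gs = map (\<lambda>f x. ?h x + f x) fs @ map (\<lambda>f x. - ?h x + f x) fs"
  have h: "1-lipschitz_on UNIV ?h" "1-lipschitz_on UNIV (\<lambda>x. - ?h x)"
    using bump_lipschitz[of t A] by (auto simp: lipschitz_on_def dist_real_def abs_minus_commute)
  have nh: "near_support t A ?h" "near_support t A (\<lambda>x. - ?h x)"
    using near_support_bump[OF \<open>finite A\<close> \<open>A \<noteq> {}\<close>, of t] by (auto simp: near_support_def)
  have "1-lipschitz_on UNIV g \<and> near_support t (A \<union> B) g" if "g \<in> set gs" for g
  proof -
    obtain k f where f: "f \<in> set fs" and k: "k = ?h \<or> k = (\<lambda>x. - ?h x)"
      and g: "g = (\<lambda>x. k x + f x)"
      using \<open>g \<in> set gs\<close> by (auto simp: gs_def simp del: uminus_add_conv_diff)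
    have "1-lipschitz_on UNIV k" "near_support t A k"
      using k h nh by auto
    with fs(2)[OF f] insert.hyps(5) show ?thesis
      unfolding g by (blast intro: lipschitz_on_add_near_support near_support_add)
  qed
  moreover have "t * length gs \<le> (\<Sum>g\<leftarrow>gs. \<bar>g u - g v\<bar>)"
    if u: "u \<in> A \<union> B" and uv: "r + t \<le> dist u v" for u v
  proof -
    have sum_gs: "(\<Sum>g\<leftarrow>gs. \<bar>g u - g v\<bar>) =
        (\<Sum>f\<leftarrow>fs. \<bar>?h u + f u - (?h v + f v)\<bar> + \<bar>- ?h u + f u - (- ?h v + f v)\<bar>)"
      by (simp add: gs_def o_def sum_list_addf)
    show ?thesis
    proof (cases "u \<in> A")
      case True
      have "t \<le> dist v a" if "a \<in> A" for a
        using diameter_bounded_bound[OF finite_imp_bounded[OF \<open>finite A\<close>] True that]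
          \<open>diameter A < r\<close> uv dist_triangle2[of u v a] by simp
      then have "t \<le> infdist v A"
        using \<open>A \<noteq> {}\<close> by (auto simp: infdist_notempty intro: cINF_greatest)
      then have "?h v = 0" "?h u = t"
        using True \<open>0 \<le> t\<close> by (auto simp: bump_def)
      \<comment> \<open>With \<open>x = f u - f v\<close>, the two signs contribute
        \<open>\<bar>t + x\<bar> + \<bar>- t + x\<bar>\<close>, which is at least
        \<open>2 * t\<close> whatever the other bumps do.\<close>
      then have "(\<Sum>f\<leftarrow>fs. 2 * t) \<le> (\<Sum>g\<leftarrow>gs. \<bar>g u - g v\<bar>)"
        unfolding sum_gs by (intro sum_list_mono) auto
      then show ?thesis
        by (simp add: gs_def sum_list_triv algebra_simps)
    next
      case False
      \<comment> \<open>Averaging over the sign of the new bump cannot decrease the mean of the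
        absolute differences, so the earlier bound survives.\<close>
      have "(\<Sum>f\<leftarrow>fs. 2 * \<bar>f u - f v\<bar>) \<le> (\<Sum>g\<leftarrow>gs. \<bar>g u - g v\<bar>)"
        unfolding sum_gs by (intro sum_list_mono) (smt (verit))
      moreover have "t * length fs \<le> (\<Sum>f\<leftarrow>fs. \<bar>f u - f v\<bar>)"
        using fs(3) u uv False by blast
      ultimately show ?thesis
        by (simp add: gs_def sum_list_const_mult algebra_simps)
    qed
  qed
  moreover have "gs \<noteq> []"
    using fs(1) by (simp add: gs_def)
  ultimately show ?case
    by blast
qed

section \<open>Exhaustion by sets with small boundary\<close>

text \<open>Removing a bad \<open>A\<close> together with its neighbours \<open>N\<close> costs
  measure at most \<open>(1 + c) * \<nu> A\<close>. All that remains is more than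
  \<open>2 * t\<close> away from \<open>A\<close>, so later pieces are separated from it.\<close>

lemma exhaust_by_separated_union:
  fixes \<nu> :: "'a::metric_space set \<Rightarrow> real" and \<Phi> :: "'a set \<Rightarrow> 'a set \<Rightarrow> 'a set"
  assumes "finite W" and "W \<subseteq> V"
    and add: "\<And>X Y. X \<subseteq> V \<Longrightarrow> Y \<subseteq> V \<Longrightarrow> X \<inter> Y = {} \<Longrightarrow> \<nu> (X \<union> Y) = \<nu> X + \<nu> Y"
    and bad: "\<And>W. W \<subseteq> V \<Longrightarrow> W \<noteq> {} \<Longrightarrow> \<exists>A\<subseteq>W. A \<noteq> {} \<and> diameter A < r \<and>
        \<nu> {v \<in> W - A. \<exists>a\<in>A. dist a v \<le> 2 * t} \<le> c * \<nu> A"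
  shows "\<exists>B\<subseteq>W. separated_union t r B \<and> \<nu> W \<le> (1 + c) * \<nu> B"
  using assms(1,2)
proof (induction W rule: finite_psubset_induct)
  case (psubset W)
  show ?case
  proof (cases "W = {}")
    case True
    have "\<nu> {} = 0"
      using add[of "{}" "{}"] by simp
    with True show ?thesis
      by (auto intro: separated_union.empty)
  next
    case False
    then obtain A where A: "A \<subseteq> W" "A \<noteq> {}" "diameter A < r"
      and le: "\<nu> {v \<in> W - A. \<exists>a\<in>A. dist a v \<le> 2 * t} \<le> c * \<nu> A"
      using bad[of W] psubset.prems by blast
    define N where "N = {v \<in> W - A. \<exists>a\<in>A. dist a v \<le> 2 * t}"
    have "W - A - N \<subset> W"
      using A by blast
    then obtain B where B: "B \<subseteq> W - A - N" "separated_union t r B"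
      and IH: "\<nu> (W - A - N) \<le> (1 + c) * \<nu> B"
      using psubset.IH[of "W - A - N"] psubset.prems by blast
    have "separated_union t r (A \<union> B)"
    proof (rule separated_union.insert)
      show "finite A"
        using A(1) psubset.hyps by (rule finite_subset)
      show "2 * t \<le> dist a b" if "a \<in> A" "b \<in> B" for a b
        using that B(1) unfolding N_def by force
    qed (use A B in auto)
    moreover have "\<nu> W \<le> (1 + c) * \<nu> (A \<union> B)"
    proof -
      have "W = A \<union> (N \<union> (W - A - N))"
        using A by (auto simp: N_def)
      also have "\<nu> \<dots> = \<nu> A + (\<nu> N + \<nu> (W - A - N))"
        using A psubset.prems by (subst add; (subst add)?) (auto simp: N_def)
      also have "\<dots> \<le> (1 + c) * (\<nu> A + \<nu> B)"
        using le IH by (simp add: N_def algebra_simps)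
      also have "\<nu> A + \<nu> B = \<nu> (A \<union> B)"
        using A B psubset.prems by (intro add[symmetric]) auto
      finally show ?thesis .
    qed
    ultimately show ?thesis
      using A B by (intro exI[of _ "A \<union> B"]) auto
  qed
qed

lemma vertex_boundary_induced_proximity:
  assumes "W \<subseteq> V" and "A \<subseteq> W"
  shows "vertex_boundary (W, {e \<in> edges (proximity_graph V s). e \<subseteq> W}) A =
    {v \<in> W - A. \<exists>a\<in>A. dist a v \<le> s}"
proof -
  have "{a, v} \<in> edges (proximity_graph V s) \<longleftrightarrow> dist a v \<le> s" if "a \<in> A" "v \<in> W - A" for a v
    using that assms by (auto simp: proximity_graph_def doubleton_eq_iff dist_commute)
  with assms show ?thesis
    by (auto simp: vertex_boundary_def) blast
qed

section \<open>Contradiction from the integral inequality\<close>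

theorem theorem2:
  fixes D :: real
    and Mn :: "nat \<Rightarrow> 'a::metric_space set"
    and \<mu> :: "nat \<Rightarrow> ('a \<times> 'a) measure"
    and n s :: nat
  assumes "locally_finite_space TYPE('a)"
    and "\<not> (\<exists>f :: 'a \<Rightarrow> L1. coarse_embedding f)"
    and "\<And>k. k \<ge> 1 \<Longrightarrow> finite (Mn k)"
    and "\<And>k. k \<ge> 1 \<Longrightarrow> prob_measure_on (Mn k \<times> Mn k) (\<mu> k)"
    and "\<And>k u v. k \<ge> 1 \<Longrightarrow> (u, v) \<in> supp (\<mu> k) \<Longrightarrow> dist u v \<ge> real k"
    and "\<And>k (f :: 'a \<Rightarrow> L1). k \<ge> 1 \<Longrightarrow> lipschitz_map f \<Longrightarrow>
           (LINT (u, v)|\<mu> k. norm (f u - f v)) \<le> D * Lip f"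
    and "n \<ge> 1" and "s \<ge> 1"
    and "2 * real n > real s" and "real s > 8 * D"
  shows "\<exists>F. induced_subgraph F (proximity_graph (Mn n) (real s)) \<and>
           diameter (verts F) \<ge> real n - real s / 2 \<and>
           (\<forall>A. A \<subseteq> verts F \<longrightarrow> A \<noteq> {} \<longrightarrow> diameter A < real n - real s / 2 \<longrightarrow>
              first_marginal (Mn n) (\<mu> n) (vertex_boundary F A)
                > phi D (real s) * first_marginal (Mn n) (\<mu> n) A)"
proof (rule ccontr)
  assume no_F: "\<not> ?thesis"
  define V where "V = Mn n"
  define m where "m = \<mu> n"
  define \<nu> where "\<nu> = first_marginal V m"
  \<comment> \<open>Nonadjacent vertices are more than \<open>2 * t\<close> apart, so
    \<open>t\<close> is the right bump radius. As \<open>r + t = n\<close>, a point at distance at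
    least \<open>n\<close> from a point of a piece of diameter below \<open>r\<close> lies outside
    its bump.\<close>
  define t where "t = real s / 2"
  define r where "r = real n - t"
  have "finite V" and m: "prob_measure_on (V \<times> V) m"
    using assms(3,4,7) by (auto simp: V_def m_def)
  then have fin: "finite (V \<times> V)"
    by simp
  interpret prob_space m
    using m by (simp add: prob_measure_on_def)
  have sp: "space m = V \<times> V" "sets m = Pow (V \<times> V)"
    using m by (auto simp: prob_measure_on_def)
  have far: "r + t \<le> dist u v" if "(u, v) \<in> supp m" for u v
    using assms(5,7) that by (simp add: m_def r_def)
  have "0 < t" and "0 < r"
    using assms(8,9) by (auto simp: t_def r_def)
  obtain e :: L1 where e: "norm e = 1"
    using ex_norm_1_L1 by blast
  have bound: "(LINT (u, v)|m. \<bar>f u - f v\<bar>) \<le> D * Lip (\<lambda>x. f x *\<^sub>R e)"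
    and lip: "lipschitz_map (\<lambda>x. f x *\<^sub>R e)" if "1-lipschitz_on UNIV f" for f :: "'a \<Rightarrow> real"
  proof -
    show "lipschitz_map (\<lambda>x. f x *\<^sub>R e)"
      using lipschitz_on_scaleR_unit[OF that e] by (auto simp: lipschitz_map_def)
    from assms(6)[OF assms(7) this] show "(LINT (u, v)|m. \<bar>f u - f v\<bar>) \<le> D * Lip (\<lambda>x. f x *\<^sub>R e)"
      by (simp add: m_def e flip: scaleR_left_diff_distrib)
  qed

  \<comment> \<open>For \<open>(u, v)\<close> in the support, the 1-Lipschitz function
    \<open>dist u\<close> has a positive integral of differences, which a nonpositive
    \<open>D\<close> would forbid.\<close>
  have "0 < D"
  proof (rule ccontr)
    assume "\<not> 0 < D"
    have "supp m \<noteq> {}"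
      using AE_supp[OF m fin] by auto
    then obtain u v where uv: "(u, v) \<in> supp m"
      by auto
    have "1-lipschitz_on UNIV (dist u)"
      by (rule lipschitz_onI)
        (simp_all add: dist_real_def, metis abs_dist_diff_le dist_commute)
    note bound[OF this]
    also have "D * Lip (\<lambda>x. dist u x *\<^sub>R e) \<le> 0"
      using \<open>\<not> 0 < D\<close> Lip_nonneg[OF lip[OF \<open>1-lipschitz_on UNIV (dist u)\<close>]]
      by (simp add: mult_nonpos_nonneg)
    finally have "(LINT (x, y)|m. \<bar>dist u x - dist u y\<bar>) \<le> 0" .
    moreover have "(r + t) * measure m {(u, v)} \<le> (LINT (x, y)|m. \<bar>dist u x - dist u y\<bar>)"
      using uv far by (intro measure_le_integral[OF m fin]) (auto simp: supp_def sp)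
    moreover have "0 < (r + t) * measure m {(u, v)}"
      using uv \<open>0 < t\<close> \<open>0 < r\<close> by (simp add: supp_def)
    ultimately show False
      by simp
  qed
  then have "0 \<le> phi D s"
    using assms(10) by (simp add: phi_def field_simps)

  have \<nu>_nonneg: "0 \<le> \<nu> X" for X
    by (simp add: \<nu>_def first_marginal_def)
  have \<nu>_add: "\<nu> (X \<union> Y) = \<nu> X + \<nu> Y" if "X \<subseteq> V" "Y \<subseteq> V" "X \<inter> Y = {}" for X Y
    using that unfolding \<nu>_def first_marginal_def
    by (subst Sigma_Un_distrib1, intro finite_measure_Union) (auto simp: sp)
  have bad: "\<exists>A\<subseteq>W. A \<noteq> {} \<and> diameter A < r \<and>
      \<nu> {v \<in> W - A. \<exists>a\<in>A. dist a v \<le> 2 * t} \<le> phi D s * \<nu> A"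
    if W: "W \<subseteq> V" "W \<noteq> {}" for W
  \<comment> \<open>A set \<open>W\<close> of small diameter is itself bad: its boundary within
    \<open>W\<close> is empty and \<open>phi D s\<close> is nonnegative. Otherwise \<open>W\<close>
    induces a candidate for \<open>F\<close>, and its failure provides \<open>A\<close>.\<close>
  proof (cases "diameter W < r")
    case True
    moreover have "\<nu> {} = 0"
      by (simp add: \<nu>_def first_marginal_def)
    ultimately show ?thesis
      using W \<nu>_nonneg \<open>0 \<le> phi D s\<close> by (intro exI[of _ W]) simp
  next
    case False
    let ?F = "(W, {e \<in> edges (proximity_graph V (real s)). e \<subseteq> W})"
    have "induced_subgraph ?F (proximity_graph V (real s))"
      using W by (simp add: induced_subgraph_def proximity_graph_def)
    moreover have "diameter (verts ?F) \<ge> real n - real s / 2"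
      using False by (simp add: r_def t_def)
    ultimately obtain A where A: "A \<subseteq> W" "A \<noteq> {}" "diameter A < r"
      and "\<not> \<nu> (vertex_boundary ?F A) > phi D s * \<nu> A"
      using no_F[unfolded not_ex, THEN spec, of ?F]
      unfolding V_def[symmetric] m_def[symmetric] \<nu>_def[symmetric] t_def[symmetric] r_def[symmetric]
        fst_conv by blast
    with W show ?thesis
      by (intro exI[of _ A]) (simp add: vertex_boundary_induced_proximity t_def)
  qed
  obtain B where B: "B \<subseteq> V" "separated_union t r B" and "\<nu> V \<le> (1 + phi D s) * \<nu> B"
    using exhaust_by_separated_union[OF \<open>finite V\<close> order_refl \<nu>_add bad] by blast
  moreover have "\<nu> V = 1"
    using prob_space by (simp add: \<nu>_def first_marginal_def sp)
  ultimately have B_large: "1 \<le> (1 + phi D s) * \<nu> B"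
    by simp

  obtain fs where fs: "fs \<noteq> []" "\<And>f. f \<in> set fs \<Longrightarrow> 1-lipschitz_on UNIV f"
    "\<And>u v. u \<in> B \<Longrightarrow> r + t \<le> dist u v \<Longrightarrow> t * length fs \<le> (\<Sum>f\<leftarrow>fs. \<bar>f u - f v\<bar>)"
    using separated_union_imp_functions[OF B(2)] \<open>0 < t\<close> by (meson less_imp_le)
  \<comment> \<open>Only pairs with first coordinate in \<open>B\<close> are counted; their total
    mass is \<open>\<nu> B\<close>, and support pairs are far enough apart for
    \<open>fs(3)\<close>.\<close>
  have "t * length fs * \<nu> B \<le> (LINT p|m. (\<Sum>f\<leftarrow>fs. \<bar>f (fst p) - f (snd p)\<bar>))"
    unfolding \<nu>_def first_marginal_def using B(1) fs(3) far
    by (intro measure_le_integral[OF m fin]) (auto intro!: sum_list_nonneg)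
  also have "\<dots> = (\<Sum>f\<leftarrow>fs. (LINT (u, v)|m. \<bar>f u - f v\<bar>))"
    by (induction fs) (simp_all add: integrable_finite_space[OF m fin] case_prod_beta)
  also have "\<dots> \<le> (\<Sum>f\<leftarrow>fs. D)"
  proof (rule sum_list_mono)
    fix f assume "f \<in> set fs"
    then have f: "1-lipschitz_on UNIV f"
      by (rule fs(2))
    have "Lip (\<lambda>x. f x *\<^sub>R e) \<le> 1"
      using f e by (intro Lip_le lipschitz_on_scaleR_unit)
    then have "D * Lip (\<lambda>x. f x *\<^sub>R e) \<le> D"
      using \<open>0 < D\<close> by simp
    with bound[OF f] show "(LINT (u, v)|m. \<bar>f u - f v\<bar>) \<le> D"
      by (rule order_trans)
  qed
  also have "\<dots> = D * length fs"
    by (simp add: sum_list_triv)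
  finally have "t * \<nu> B \<le> D"
    using fs(1) by (simp add: mult_ac)
  \<comment> \<open>Since \<open>(1 + phi D s) * D = s / 4 - D\<close>, the chain ends in
    \<open>t \<le> t / 2 - D\<close>, impossible for positive \<open>t\<close> and
    \<open>D\<close>.\<close>
  have "t \<le> t * ((1 + phi D s) * \<nu> B)"
    using B_large \<open>0 < t\<close> by simp
  also have "\<dots> = (1 + phi D s) * (t * \<nu> B)"
    by simp
  also have "\<dots> \<le> (1 + phi D s) * D"
    using \<open>t * \<nu> B \<le> D\<close> \<open>0 \<le> phi D s\<close> by (intro mult_left_mono) auto
  also have "\<dots> = t / 2 - D"
    using \<open>0 < D\<close> by (simp add: phi_def t_def field_simps)
  finally show False
    using \<open>0 < t\<close> \<open>0 < D\<close> by simp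
qed

end
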